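(* Let $A$ be a finite nonempty set. There is a one-to-one correspondence between generalized quasiorders on $A$ and arbitrary pairs $(\sigma,\tau)$ consisting of an equivalence relation $\sigma$ on $A$ and a weak generalized partial order $\tau$ on $A/\sigma$, given by $\rho\mapsto(\rho^{\langle2\rangle},\rho/\rho^{\langle2\rangle})$. In particular, $\rho^{\langle2\rangle}=\rho'^{\langle2\rangle}$ and $\rho/\rho^{\langle2\rangle}=\rho'/\rho'^{\langle2\rangle}$ implies $\rho=\rho'$ for any generalized quasiorders $\rho,\rho'$ on $A$.
   Context: For any finite nonempty set $X$ and $m\ge1$, a relation $\rho\subseteq X^m$ is reflexive if $(a,\dots,a)\in\rho$ for all $a\in X$; it is (generalized) transitive if for every matrix $(a_{ij})\in X^{m\times m}$ all of whose rows and all of whose columns belong to $\rho$, the diagonal $(a_{11},\dots,a_{mm})$ belongs to $\rho$. A generalized quasiorder on $X$ is a reflexive and transitive relation (of some finite arity $m\ge1$; the correspondence preserves the arity, i.e. $\tau$ has the same arity as $\rho$). For $\rho\subseteq X^m$, elements $a,b\in X$ are exchangeable with respect to $\rho$ if for every $i\in\{1,\dots,m\}$ and all $a_1,\dots,a_{i-1},a_{i+1},\dots,a_m\in X$: $(a_1,\dots,a_{i-1},a,a_{i+1},\dots,a_m)\in\rho\iff(a_1,\dots,a_{i-1},b,a_{i+1},\dots,a_m)\in\rho$. $\rho^{\langle2\rangle}$ is the set of all pairs $(a,b)\in X^2$ of elements exchangeable with respect to $\rho$; it is an equivalence relation. A generalized quasiorder $\rho$ on $X$ is a weak generalized partial order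 if $\rho^{\langle2\rangle}=\{(a,a)\mid a\in X\}$. For an equivalence relation $\psi$ on $A$, $[a]_\psi$ is the $\psi$-class of $a$, $A/\psi$ the set of classes, and the factor relation is $\rho/\psi:=\{([a_1]_\psi,\dots,[a_m]_\psi)\mid(a_1,\dots,a_m)\in\rho\}\subseteq(A/\psi)^m$. *)

theory Defs
  imports Main
begin

text \<open>
  An \<open>m\<close>-ary relation on a set \<open>X\<close> is a set of lists over \<open>X\<close> of length \<open>m\<close>; coordinates are
  numbered from \<open>0\<close>.
\<close>

definition tuples :: "nat \<Rightarrow> 'a set \<Rightarrow> 'a list set" where
  "tuples m X = {xs. length xs = m \<and> set xs \<subseteq> X}"

definition gen_reflexive :: "nat \<Rightarrow> 'a set \<Rightarrow> 'a list set \<Rightarrow> bool" where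
  "gen_reflexive m X \<rho> \<longleftrightarrow> (\<forall>a\<in>X. replicate m a \<in> \<rho>)"

definition gen_transitive :: "nat \<Rightarrow> 'a set \<Rightarrow> 'a list set \<Rightarrow> bool" where
  "gen_transitive m X \<rho> \<longleftrightarrow>
     (\<forall>M :: nat \<Rightarrow> nat \<Rightarrow> 'a.
        (\<forall>i<m. \<forall>j<m. M i j \<in> X) \<longrightarrow>
        (\<forall>i<m. map (\<lambda>j. M i j) [0..<m] \<in> \<rho>) \<longrightarrow>
        (\<forall>j<m. map (\<lambda>i. M i j) [0..<m] \<in> \<rho>) \<longrightarrow>
        map (\<lambda>i. M i i) [0..<m] \<in> \<rho>)"

definition gen_quasiorder :: "nat \<Rightarrow> 'a set \<Rightarrow> 'a list set \<Rightarrow> bool" where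
  "gen_quasiorder m X \<rho> \<longleftrightarrow>
     m \<ge> 1 \<and> \<rho> \<subseteq> tuples m X \<and> gen_reflexive m X \<rho> \<and> gen_transitive m X \<rho>"

text \<open>
  The arity does not occur in the next definition: for an \<open>m\<close>-ary \<open>\<rho>\<close>, lists \<open>xs\<close> of length
  different from \<open>m\<close> make both memberships false and impose no condition.
\<close>

definition exchangeable :: "'a set \<Rightarrow> 'a list set \<Rightarrow> 'a \<Rightarrow> 'a \<Rightarrow> bool" where
  "exchangeable X \<rho> a b \<longleftrightarrow>
     (\<forall>xs\<in>lists X. \<forall>i<length xs. xs[i := a] \<in> \<rho> \<longleftrightarrow> xs[i := b] \<in> \<rho>)"

definition exch_rel :: "'a set \<Rightarrow> 'a list set \<Rightarrow> ('a \<times> 'a) set" where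
  "exch_rel X \<rho> = {(a, b). a \<in> X \<and> b \<in> X \<and> exchangeable X \<rho> a b}"

definition weak_gen_partial_order :: "nat \<Rightarrow> 'a set \<Rightarrow> 'a list set \<Rightarrow> bool" where
  "weak_gen_partial_order m X \<rho> \<longleftrightarrow> gen_quasiorder m X \<rho> \<and> exch_rel X \<rho> = Id_on X"

definition factor_rel :: "'a list set \<Rightarrow> ('a \<times> 'a) set \<Rightarrow> 'a set list set" where
  "factor_rel \<rho> \<psi> = map (\<lambda>a. \<psi> `` {a}) ` \<rho>"

end

theory Submission
  imports Defs
begin

text \<open>
  The inverse of the correspondence sends \<open>(\<sigma>, \<tau>)\<close> to the preimage of \<open>\<tau>\<close> under the projection
  \<open>A \<rightarrow> A/\<sigma>\<close>. Pulling back along a surjection preserves and reflects reflexivity, transitivity and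
  exchangeability, and \<open>\<rho>\<close> is recovered from \<open>\<rho>/\<rho>\<^sup>\<langle>\<^sup>2\<^sup>\<rangle>\<close> because replacing the entries
  of a tuple one at a time by exchangeable ones does not affect membership in \<open>\<rho>\<close>.
\<close>

text \<open>The arity is not a parameter: \<open>map\<close> preserves length, so the tuples of
  \<tau> fix the lengths of those in the preimage. A single inverse map thus serves all
  arities.\<close>

definition pullback_rel :: "'a set \<Rightarrow> ('a \<times> 'a) set \<Rightarrow> 'a set list set \<Rightarrow> 'a list set" where
  "pullback_rel A \<sigma> \<tau> = {xs \<in> lists A. map (\<lambda>a. \<sigma> `` {a}) xs \<in> \<tau>}"

lemma tuples_subset_lists: "tuples m X \<subseteq> lists X"
  by (auto simp: tuples_def)

lemma gen_quasiorder_subset_lists: "gen_quasiorder m X \<rho> \<Longrightarrow> \<rho> \<subseteq> lists X"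
  using tuples_subset_lists unfolding gen_quasiorder_def by blast

lemma equiv_exch_rel: "equiv X (exch_rel X \<rho>)"
  by (rule equivI) (auto simp: exch_rel_def exchangeable_def refl_on_def sym_def trans_def)

text \<open>Induction along the part still to be replaced. The prefix \<open>zs\<close> holds the
  entries already replaced, so it must vary in the induction; the application takes
  \<open>zs = []\<close>.\<close>

lemma exch_rel_saturated:
  assumes "list_all2 (\<lambda>a b. (a, b) \<in> exch_rel X \<rho>) xs ys" and "zs \<in> lists X"
    and "zs @ xs \<in> \<rho>"
  shows "zs @ ys \<in> \<rho>"
  using assms
proof (induction xs ys arbitrary: zs rule: list_all2_induct)
  case Nil
  then show ?case by simp
next
  case (Cons x xs y ys)
  have xs: "xs \<in> lists X"
    using Cons.hyps(2) by (induction rule: list_all2_induct) (auto simp: exch_rel_def)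
  have xy: "x \<in> X" "y \<in> X" "exchangeable X \<rho> x y"
    using Cons.hyps(1) by (auto simp: exch_rel_def)
  have "zs @ x # xs \<in> lists X" "length zs < length (zs @ x # xs)"
    using xs xy Cons.prems by auto
  \<comment> \<open>The entry at position \<open>length zs\<close> is \<open>x\<close> already, so
    the left update leaves the list unchanged and the right one performs a single exchange.\<close>
  with xy(3) have "(zs @ x # xs)[length zs := x] \<in> \<rho> \<longleftrightarrow> (zs @ x # xs)[length zs := y] \<in> \<rho>"
    unfolding exchangeable_def by blast
  with Cons.prems have "(zs @ [y]) @ xs \<in> \<rho>"
    by simp
  moreover have "zs @ [y] \<in> lists X"
    using Cons.prems xy by simp
  ultimately have "(zs @ [y]) @ ys \<in> \<rho>"
    by (intro Cons.IH)
  then show ?case by simp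
qed

text \<open>A tuple in the preimage has the same classes as some tuple of \<rho>. The two are
  therefore entrywise exchangeable, and saturation carries membership over.\<close>

lemma pullback_factor_rel:
  assumes "\<rho> \<subseteq> lists A"
  shows "pullback_rel A (exch_rel A \<rho>) (factor_rel \<rho> (exch_rel A \<rho>)) = \<rho>"
proof
  let ?\<sigma> = "exch_rel A \<rho>"
  show "pullback_rel A ?\<sigma> (factor_rel \<rho> ?\<sigma>) \<subseteq> \<rho>"
  proof
    fix ys assume "ys \<in> pullback_rel A ?\<sigma> (factor_rel \<rho> ?\<sigma>)"
    then obtain xs where xs: "xs \<in> \<rho>" "map (\<lambda>a. ?\<sigma> `` {a}) ys = map (\<lambda>a. ?\<sigma> `` {a}) xs"
      and ys: "ys \<in> lists A"
      by (auto simp: pullback_rel_def factor_rel_def)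
    have len: "length xs = length ys"
      using xs(2) by (metis length_map)
    have "list_all2 (\<lambda>a b. (a, b) \<in> ?\<sigma>) xs ys"
      unfolding list_all2_conv_all_nth
    proof (intro conjI allI impI len)
      fix i assume i: "i < length xs"
      have "?\<sigma> `` {xs ! i} = ?\<sigma> `` {ys ! i}"
        using xs(2) i len by (metis nth_map)
      \<comment> \<open>Outside \<open>A\<close> all images under \<open>?\<sigma>\<close> are
        empty, so equal images give related entries only once an entry is known to lie in
        \<open>A\<close>.\<close>
      moreover have "ys ! i \<in> A"
        using ys i len by (simp add: in_listsD)
      ultimately show "(xs ! i, ys ! i) \<in> ?\<sigma>"
        using eq_equiv_class[OF _ equiv_exch_rel] by metis
    qed
    from exch_rel_saturated[OF this, of "[]"] xs(1) show "ys \<in> \<rho>" by simp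
  qed
  show "\<rho> \<subseteq> pullback_rel A ?\<sigma> (factor_rel \<rho> ?\<sigma>)"
    using assms by (auto simp: pullback_rel_def factor_rel_def)
qed

text \<open>Choosing representatives entrywise lifts any tuple of classes. As a rewrite rule this
  turns quantifiers over tuples on the quotient into quantifiers over tuples on
  \<open>A\<close>.\<close>

lemma lists_quotient: "lists (A // \<sigma>) = map (\<lambda>a. \<sigma> `` {a}) ` lists A"
proof -
  have "A // \<sigma> = (\<lambda>a. \<sigma> `` {a}) ` A"
    by (auto simp: quotient_def)
  then show ?thesis
    by (simp add: lists_image)
qed

lemma factor_pullback_rel:
  assumes "\<tau> \<subseteq> lists (A // \<sigma>)"
  shows "factor_rel (pullback_rel A \<sigma> \<tau>) \<sigma> = \<tau>"
  using assms unfolding lists_quotient factor_rel_def pullback_rel_def by auto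

text \<open>The projection commutes with changing one coordinate, and every tuple of classes lifts
  to \<open>A\<close>, so both sides express the same family of conditions.\<close>

lemma exchangeable_pullback_iff:
  assumes "a \<in> A" and "b \<in> A"
  shows "exchangeable A (pullback_rel A \<sigma> \<tau>) a b \<longleftrightarrow>
    exchangeable (A // \<sigma>) \<tau> (\<sigma> `` {a}) (\<sigma> `` {b})"
proof -
  have "xs[i := c] \<in> lists A" if "xs \<in> lists A" "c \<in> A" for xs i c
    using that set_update_subset_insert[of xs i c] by auto
  then show ?thesis
    using assms unfolding exchangeable_def lists_quotient
    by (simp add: pullback_rel_def map_update)
qed

text \<open>Each clause passes through the surjective projection. For transitivity, a matrix of
  classes is lifted by representatives in one direction, and a matrix over \<open>A\<close> is
  projected in the other.\<close>

lemma gen_quasiorder_pullback_iff: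
  assumes "\<tau> \<subseteq> lists (A // \<sigma>)"
  shows "gen_quasiorder m A (pullback_rel A \<sigma> \<tau>) \<longleftrightarrow> gen_quasiorder m (A // \<sigma>) \<tau>"
proof -
  let ?p = "\<lambda>a. \<sigma> `` {a}"
  let ?\<rho> = "pullback_rel A \<sigma> \<tau>"
  have quot: "A // \<sigma> = ?p ` A"
    by (auto simp: quotient_def)
  have "?\<rho> \<subseteq> tuples m A \<longleftrightarrow> (\<forall>xs\<in>lists A. map ?p xs \<in> \<tau> \<longrightarrow> length xs = m)"
    by (auto simp: pullback_rel_def tuples_def)
  also have "\<dots> \<longleftrightarrow> (\<forall>ys\<in>lists (A // \<sigma>). ys \<in> \<tau> \<longrightarrow> length ys = m)"
    by (simp add: lists_quotient)
  also have "\<dots> \<longleftrightarrow> \<tau> \<subseteq> tuples m (A // \<sigma>)"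
    using assms by (auto simp: tuples_def)
  finally have sub: "?\<rho> \<subseteq> tuples m A \<longleftrightarrow> \<tau> \<subseteq> tuples m (A // \<sigma>)" .
  have refl: "gen_reflexive m A ?\<rho> \<longleftrightarrow> gen_reflexive m (A // \<sigma>) \<tau>"
    by (auto simp: gen_reflexive_def quot pullback_rel_def)
  have mem: "map f [0..<m] \<in> ?\<rho> \<longleftrightarrow> map (\<lambda>i. ?p (f i)) [0..<m] \<in> \<tau>"
    if "\<forall>i<m. f i \<in> A" for f
    using that by (auto simp: pullback_rel_def comp_def)
  have trans: "gen_transitive m A ?\<rho> \<longleftrightarrow> gen_transitive m (A // \<sigma>) \<tau>"
  proof
    assume tr: "gen_transitive m A ?\<rho>"
    show "gen_transitive m (A // \<sigma>) \<tau>"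
      unfolding gen_transitive_def
    proof (intro allI impI)
      fix M
      assume M: "\<forall>i<m. \<forall>j<m. M i j \<in> A // \<sigma>"
        and rows: "\<forall>i<m. map (\<lambda>j. M i j) [0..<m] \<in> \<tau>"
        and cols: "\<forall>j<m. map (\<lambda>i. M i j) [0..<m] \<in> \<tau>"
      \<comment> \<open>\<open>N\<close> is a matrix of chosen representatives, one for each class
        occurring in \<open>M\<close>.\<close>
      define N where "N i j = inv_into A ?p (M i j)" for i j
      have N: "N i j \<in> A" "?p (N i j) = M i j" if "i < m" "j < m" for i j
      proof -
        have "M i j \<in> ?p ` A"
          using M that quot by blast
        then show "N i j \<in> A" "?p (N i j) = M i j"
          unfolding N_def by (rule inv_into_into, rule f_inv_into_f)
      qed
      \<comment> \<open>The index functions \<open>f\<close> and \<open>g\<close> trace a path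
        through the matrix; making one of them constant and the other the identity yields a row or a
        column.\<close>
      have lift: "map (\<lambda>k. N (f k) (g k)) [0..<m] \<in> ?\<rho>"
        if "\<forall>k<m. f k < m \<and> g k < m" and "map (\<lambda>k. M (f k) (g k)) [0..<m] \<in> \<tau>" for f g
      proof -
        have "map (\<lambda>k. ?p (N (f k) (g k))) [0..<m] = map (\<lambda>k. M (f k) (g k)) [0..<m]"
          using that(1) by (simp add: N)
        also note that(2)
        finally show ?thesis
          using that(1) by (simp add: mem N)
      qed
      have "\<forall>i<m. map (\<lambda>j. N i j) [0..<m] \<in> ?\<rho>"
        using rows lift[of "\<lambda>_. i" "\<lambda>j. j" for i] by blast
      moreover have "\<forall>j<m. map (\<lambda>i. N i j) [0..<m] \<in> ?\<rho>"
        using cols lift[of "\<lambda>i. i" "\<lambda>_. j" for j] by blast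
      ultimately have "map (\<lambda>i. N i i) [0..<m] \<in> ?\<rho>"
        using tr N unfolding gen_transitive_def by blast
      then have "map (\<lambda>i. ?p (N i i)) [0..<m] \<in> \<tau>"
        by (simp add: mem N)
      moreover have "map (\<lambda>i. ?p (N i i)) [0..<m] = map (\<lambda>i. M i i) [0..<m]"
        by (simp add: N)
      ultimately show "map (\<lambda>i. M i i) [0..<m] \<in> \<tau>"
        by metis
    qed
  next
    assume tr: "gen_transitive m (A // \<sigma>) \<tau>"
    show "gen_transitive m A ?\<rho>"
      unfolding gen_transitive_def
    proof (intro allI impI)
      fix M
      assume M: "\<forall>i<m. \<forall>j<m. M i j \<in> A"
        and rows: "\<forall>i<m. map (\<lambda>j. M i j) [0..<m] \<in> ?\<rho>"
        and cols: "\<forall>j<m. map (\<lambda>i. M i j) [0..<m] \<in> ?\<rho>"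
      \<comment> \<open>No representatives have to be chosen here: the matrix is projected
        entrywise.\<close>
      have "\<forall>i<m. \<forall>j<m. ?p (M i j) \<in> A // \<sigma>"
        using M by (simp add: quotientI)
      moreover have "\<forall>i<m. map (\<lambda>j. ?p (M i j)) [0..<m] \<in> \<tau>"
        using M rows by (simp add: mem)
      moreover have "\<forall>j<m. map (\<lambda>i. ?p (M i j)) [0..<m] \<in> \<tau>"
        using M cols by (simp add: mem)
      ultimately have "map (\<lambda>i. ?p (M i i)) [0..<m] \<in> \<tau>"
        using tr[unfolded gen_transitive_def, rule_format, of "\<lambda>i j. ?p (M i j)"] by blast
      then show "map (\<lambda>i. M i i) [0..<m] \<in> ?\<rho>"
        using M by (simp add: mem)
    qed
  qed
  show ?thesis
    unfolding gen_quasiorder_def by (simp only: sub refl trans)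
qed

text \<open>Elements are exchangeable for the preimage iff their classes are exchangeable for
  \<tau>. By the second hypothesis this means that the classes coincide, that is, the elements are
  \<sigma>-related.\<close>

lemma exch_rel_pullback:
  assumes "equiv A \<sigma>" and "exch_rel (A // \<sigma>) \<tau> = Id_on (A // \<sigma>)"
  shows "exch_rel A (pullback_rel A \<sigma> \<tau>) = \<sigma>"
proof -
  have "(a, b) \<in> exch_rel A (pullback_rel A \<sigma> \<tau>) \<longleftrightarrow> (a, b) \<in> \<sigma>" for a b
  proof -
    have "(a, b) \<in> exch_rel A (pullback_rel A \<sigma> \<tau>) \<longleftrightarrow>
        a \<in> A \<and> b \<in> A \<and> (\<sigma> `` {a}, \<sigma> `` {b}) \<in> exch_rel (A // \<sigma>) \<tau>"
      by (auto simp: exch_rel_def exchangeable_pullback_iff quotientI)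
    also have "\<dots> \<longleftrightarrow> a \<in> A \<and> b \<in> A \<and> \<sigma> `` {a} = \<sigma> `` {b}"
      by (auto simp: assms(2) Id_on_iff quotientI)
    also have "\<dots> \<longleftrightarrow> (a, b) \<in> \<sigma>"
      using equiv_class_eq_iff[OF assms(1)] by blast
    finally show ?thesis .
  qed
  then show ?thesis by auto
qed

text \<open>Since \<rho> is the preimage of its own factor relation, the equivalences for preimages
  can be read from \<rho> down to the quotient.\<close>

lemma weak_gen_partial_order_factor_rel:
  assumes "gen_quasiorder m A \<rho>"
  shows "weak_gen_partial_order m (A // exch_rel A \<rho>) (factor_rel \<rho> (exch_rel A \<rho>))"
proof -
  let ?\<sigma> = "exch_rel A \<rho>"
  let ?\<tau> = "factor_rel \<rho> ?\<sigma>"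
  note sub = gen_quasiorder_subset_lists[OF assms]
  have \<tau>: "?\<tau> \<subseteq> lists (A // ?\<sigma>)"
    using sub by (auto simp: lists_quotient factor_rel_def)
  have qo: "gen_quasiorder m (A // ?\<sigma>) ?\<tau>"
    using assms gen_quasiorder_pullback_iff[OF \<tau>, of m] by (simp add: pullback_factor_rel[OF sub])
  have iff: "(?\<sigma> `` {a}, ?\<sigma> `` {b}) \<in> exch_rel (A // ?\<sigma>) ?\<tau> \<longleftrightarrow> ?\<sigma> `` {a} = ?\<sigma> `` {b}"
    if "a \<in> A" "b \<in> A" for a b
  proof -
    have "(?\<sigma> `` {a}, ?\<sigma> `` {b}) \<in> exch_rel (A // ?\<sigma>) ?\<tau> \<longleftrightarrow>
        exchangeable (A // ?\<sigma>) ?\<tau> (?\<sigma> `` {a}) (?\<sigma> `` {b})"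
      using that by (simp add: exch_rel_def[of "A // ?\<sigma>"] quotientI)
    also have "\<dots> \<longleftrightarrow> exchangeable A \<rho> a b"
      using exchangeable_pullback_iff[OF that, of ?\<sigma> ?\<tau>] by (simp add: pullback_factor_rel[OF sub])
    also have "\<dots> \<longleftrightarrow> (a, b) \<in> ?\<sigma>"
      using that by (simp add: exch_rel_def)
    also have "\<dots> \<longleftrightarrow> ?\<sigma> `` {a} = ?\<sigma> `` {b}"
      using that equiv_class_eq_iff[OF equiv_exch_rel] by metis
    finally show ?thesis .
  qed
  have "(U, V) \<in> exch_rel (A // ?\<sigma>) ?\<tau> \<longleftrightarrow> (U, V) \<in> Id_on (A // ?\<sigma>)" for U V
  proof (cases "U \<in> A // ?\<sigma> \<and> V \<in> A // ?\<sigma>")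
    case True
    then obtain a b where "a \<in> A" "b \<in> A" "U = ?\<sigma> `` {a}" "V = ?\<sigma> `` {b}"
      by (auto elim!: quotientE)
    with iff True show ?thesis by (simp add: Id_on_iff)
  next
    case False
    then show ?thesis by (auto simp: exch_rel_def[of "A // ?\<sigma>"])
  qed
  then have "exch_rel (A // ?\<sigma>) ?\<tau> = Id_on (A // ?\<sigma>)" by auto
  with qo show ?thesis
    by (simp add: weak_gen_partial_order_def)
qed

text \<open>The set \<open>I\<close> of admissible arities covers both versions of the
  correspondence: \<open>UNIV\<close> gives all arities together, a singleton gives one fixed
  arity.\<close>

lemma bij_betw_gen_quasiorder:
  "bij_betw (\<lambda>\<rho>. (exch_rel A \<rho>, factor_rel \<rho> (exch_rel A \<rho>)))
     {\<rho>. \<exists>m\<in>I. gen_quasiorder m A \<rho>}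
     {(\<sigma>, \<tau>). equiv A \<sigma> \<and> (\<exists>m\<in>I. weak_gen_partial_order m (A // \<sigma>) \<tau>)}"
proof (rule bij_betw_byWitness[where f' = "\<lambda>(\<sigma>, \<tau>). pullback_rel A \<sigma> \<tau>"])
  \<comment> \<open>The same \<open>m\<close> occurs for \<tau> and for its preimage, so the inverse
    map respects the restriction of arities to \<open>I\<close>.\<close>
  have inv: "exch_rel A (pullback_rel A \<sigma> \<tau>) = \<sigma> \<and> factor_rel (pullback_rel A \<sigma> \<tau>) \<sigma> = \<tau> \<and>
      gen_quasiorder m A (pullback_rel A \<sigma> \<tau>)"
    if "equiv A \<sigma>" "weak_gen_partial_order m (A // \<sigma>) \<tau>" for \<sigma> \<tau> m
    using that gen_quasiorder_subset_lists[of m "A // \<sigma>" \<tau>]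
    by (simp add: weak_gen_partial_order_def exch_rel_pullback factor_pullback_rel
        gen_quasiorder_pullback_iff)
  show "\<forall>\<rho>\<in>{\<rho>. \<exists>m\<in>I. gen_quasiorder m A \<rho>}.
      (case (exch_rel A \<rho>, factor_rel \<rho> (exch_rel A \<rho>)) of (\<sigma>, \<tau>) \<Rightarrow> pullback_rel A \<sigma> \<tau>) = \<rho>"
    by (auto simp: pullback_factor_rel[OF gen_quasiorder_subset_lists])
  show "\<forall>p\<in>{(\<sigma>, \<tau>). equiv A \<sigma> \<and> (\<exists>m\<in>I. weak_gen_partial_order m (A // \<sigma>) \<tau>)}.
      (exch_rel A (case p of (\<sigma>, \<tau>) \<Rightarrow> pullback_rel A \<sigma> \<tau>),
       factor_rel (case p of (\<sigma>, \<tau>) \<Rightarrow> pullback_rel A \<sigma> \<tau>)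
         (exch_rel A (case p of (\<sigma>, \<tau>) \<Rightarrow> pullback_rel A \<sigma> \<tau>))) = p"
    using inv by auto
  show "(\<lambda>\<rho>. (exch_rel A \<rho>, factor_rel \<rho> (exch_rel A \<rho>))) ` {\<rho>. \<exists>m\<in>I. gen_quasiorder m A \<rho>}
      \<subseteq> {(\<sigma>, \<tau>). equiv A \<sigma> \<and> (\<exists>m\<in>I. weak_gen_partial_order m (A // \<sigma>) \<tau>)}"
    using weak_gen_partial_order_factor_rel by (fastforce intro: equiv_exch_rel)
  show "(\<lambda>(\<sigma>, \<tau>). pullback_rel A \<sigma> \<tau>) `
      {(\<sigma>, \<tau>). equiv A \<sigma> \<and> (\<exists>m\<in>I. weak_gen_partial_order m (A // \<sigma>) \<tau>)}
      \<subseteq> {\<rho>. \<exists>m\<in>I. gen_quasiorder m A \<rho>}"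
    using inv by auto
qed

theorem corollary4p9:
  fixes A :: "'a set"
  assumes "finite A" and "A \<noteq> {}"
  shows
    "bij_betw (\<lambda>\<rho>. (exch_rel A \<rho>, factor_rel \<rho> (exch_rel A \<rho>)))
       {\<rho>. \<exists>m. gen_quasiorder m A \<rho>}
       {(\<sigma>, \<tau>). equiv A \<sigma> \<and> (\<exists>m. weak_gen_partial_order m (A // \<sigma>) \<tau>)} \<and>
     (\<forall>m\<ge>1. bij_betw (\<lambda>\<rho>. (exch_rel A \<rho>, factor_rel \<rho> (exch_rel A \<rho>)))
       {\<rho>. gen_quasiorder m A \<rho>}
       {(\<sigma>, \<tau>). equiv A \<sigma> \<and> weak_gen_partial_order m (A // \<sigma>) \<tau>}) \<and>
     (\<forall>\<rho> \<rho>'. (\<exists>m. gen_quasiorder m A \<rho>) \<longrightarrow> (\<exists>m. gen_quasiorder m A \<rho>') \<longrightarrow>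
       exch_rel A \<rho> = exch_rel A \<rho>' \<longrightarrow>
       factor_rel \<rho> (exch_rel A \<rho>) = factor_rel \<rho>' (exch_rel A \<rho>') \<longrightarrow> \<rho> = \<rho>')"
proof (intro conjI allI impI)
  let ?f = "\<lambda>\<rho>. (exch_rel A \<rho>, factor_rel \<rho> (exch_rel A \<rho>))"
  show all: "bij_betw ?f {\<rho>. \<exists>m. gen_quasiorder m A \<rho>}
      {(\<sigma>, \<tau>). equiv A \<sigma> \<and> (\<exists>m. weak_gen_partial_order m (A // \<sigma>) \<tau>)}"
    using bij_betw_gen_quasiorder[of A UNIV] by simp
  show "bij_betw ?f {\<rho>. gen_quasiorder m A \<rho>}
      {(\<sigma>, \<tau>). equiv A \<sigma> \<and> weak_gen_partial_order m (A // \<sigma>) \<tau>}" for m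
    using bij_betw_gen_quasiorder[of A "{m}"] by simp
  fix \<rho> \<rho>'
  assume "\<exists>m. gen_quasiorder m A \<rho>" and "\<exists>m. gen_quasiorder m A \<rho>'"
    and "exch_rel A \<rho> = exch_rel A \<rho>'"
    and "factor_rel \<rho> (exch_rel A \<rho>) = factor_rel \<rho>' (exch_rel A \<rho>')"
  then show "\<rho> = \<rho>'"
    \<comment> \<open>The last claim is the injectivity contained in the first bijection, so the two
      quasiorders may a priori differ in arity.\<close>
    using inj_onD[OF bij_betw_imp_inj_on[OF all], of \<rho> \<rho>'] by simp
qed

end
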